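(* Let $\mathbb{T}^n$ be the flat $n$-torus with canonical coordinates $q_i\in\mathbb{R}/\mathbb{Z}$, and consider on $\mathcal{S}^{\mathrm{conf}}(T^1\mathbb{T}^n)$ the Hamiltonian $H(q_1,\dots,q_n,p_1,\dots,p_n,\theta)=p_1$. The Hamiltonian flow is $$\varphi_t^H(q_1,\dots,q_n,p_1,\dots,p_n,\theta)=(q_1+t,q_2,\dots,q_n,p_1,\dots,p_n,\theta).$$ This flow preserves the conformal 2-form $\omega$, and the zero level $\{H=0\}$ contains a loop $\gamma$ such that $\int_\gamma\eta\neq 0$.
   Context: For a closed 1-form $\eta$ put $\mathrm{d}_\eta\alpha:=\mathrm{d}\alpha-\eta\wedge\alpha$. A conformal symplectic manifold $(M,\eta,\omega)$ is an even-dimensional manifold with a closed 1-form $\eta$ (Lee form) and a non-degenerate 2-form $\omega$ (conformal 2-form) with $\mathrm{d}_\eta\omega=0$. The Hamiltonian vector field $X$ of $H:M\to\mathbb{R}$ is defined by $\iota_X\omega=\mathrm{d}_\eta H=\mathrm{d}H-H\eta$, and the Hamiltonian flow $(\varphi_t^H)$ is its flow. For a manifold $Y$ with contact form $\alpha$, the conformal symplectization $\mathcal{S}^{\mathrm{conf}}(Y,\alpha)$ is $Y\times S^1$, $S^1=\mathbb{R}/\mathbb{Z}$, with $\eta=-\mathrm{d}\theta$ and $\omega=-\mathrm{d}_\eta(\pi^*\alpha)$, where $\pi:Y\times S^1\to Y$ and $\theta:Y\times S^1\to S^1$ are the projections. Here $Y=T^1\mathbb{T}^n=\{(q,p)\in\mathbb{T}^n\times\mathbb{R}^n:\|p\|=1\}$,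 with contact form the restriction of the Liouville form $\sum_i p_i\,\mathrm{d}q_i$.
   Formalization: The claim that the zero level {H=0} contains a loop with nonzero integral of η is stated only for n ≥ 2; for n = 1 one has p_1 = ±1, so {H=0} is empty and the claim fails. *)

theory Defs
  imports "HOL-Analysis.Analysis"
begin

section \<open>The circle and the ambient manifold\<close>

quotient_type circle = real / "\<lambda>x y :: real. x - y \<in> \<int>"
  morphisms rep_circle circle_of
proof (rule equivpI)
  show "reflp (\<lambda>x y :: real. x - y \<in> \<int>)" by (simp add: reflp_def)
  show "symp (\<lambda>x y :: real. x - y \<in> \<int>)"
  proof (rule sympI)
    fix x y :: real assume "x - y \<in> \<int>"
    then have "- (x - y) \<in> \<int>" by (rule Ints_minus)
    then show "y - x \<in> \<int>" by simp
  qed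
  show "transp (\<lambda>x y :: real. x - y \<in> \<int>)"
  proof (rule transpI)
    fix x y z :: real assume "x - y \<in> \<int>" "y - z \<in> \<int>"
    then have "(x - y) + (y - z) \<in> \<int>" by (rule Ints_add)
    then show "x - z \<in> \<int>" by simp
  qed
qed

instantiation circle :: ab_group_add
begin

lift_definition zero_circle :: circle is 0 .

lift_definition plus_circle :: "circle \<Rightarrow> circle \<Rightarrow> circle" is "(+)"
proof -
  fix a b c d :: real assume "a - b \<in> \<int>" "c - d \<in> \<int>"
  then have "(a - b) + (c - d) \<in> \<int>" by (rule Ints_add)
  then show "(a + c) - (b + d) \<in> \<int>" by (simp add: algebra_simps)
qed

lift_definition uminus_circle :: "circle \<Rightarrow> circle" is uminus
proof -
  fix a b :: real assume "a - b \<in> \<int>"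
  then have "- (a - b) \<in> \<int>" by (rule Ints_minus)
  then show "(- a) - (- b) \<in> \<int>" by simp
qed

lift_definition minus_circle :: "circle \<Rightarrow> circle \<Rightarrow> circle" is "(-)"
proof -
  fix a b c d :: real assume "a - b \<in> \<int>" "c - d \<in> \<int>"
  then have "(a - b) - (c - d) \<in> \<int>" by (rule Ints_diff)
  then show "(a - c) - (b - d) \<in> \<int>" by (simp add: algebra_simps)
qed

instance
  by standard (transfer; simp)+

end

text \<open>
  All manifolds below are subsets of \<open>N = (\<real>/\<int>)\<^sup>n \<times> \<real>\<^sup>n \<times> \<real>/\<int>\<close>, with points
  \<open>((q, p), \<theta>)\<close>.  As \<open>N\<close> is the quotient of the vector space
  \<open>E = \<real>\<^sup>n \<times> \<real>\<^sup>n \<times> \<real>\<close> by a discrete group of translations, every tangent space of \<open>N\<close> is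
  canonically \<open>E\<close>, and \<open>w \<mapsto> x + cover w\<close> is, near \<open>0\<close>, the inverse of the
  standard chart of \<open>N\<close> centred at \<open>x\<close>.
\<close>

type_synonym 'n cotangent = "(circle ^ 'n) \<times> (real ^ 'n)"
type_synonym 'n cotangent_vec = "(real ^ 'n) \<times> (real ^ 'n)"
type_synonym 'n pt = "'n cotangent \<times> circle"
type_synonym 'n tvec = "'n cotangent_vec \<times> real"

definition cover :: "'n::finite tvec \<Rightarrow> 'n pt" where
  "cover = (\<lambda>((u, v), s). ((\<chi> i. circle_of (u $ i), v), circle_of s))"

text \<open>
  A curve has velocity \<open>v\<close> at \<open>t\<close> if its expression in the chart at \<open>c t\<close> has derivative \<open>v\<close>
  there; this includes continuity of \<open>c\<close> at \<open>t\<close>.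
\<close>

definition has_velocity :: "(real \<Rightarrow> 'n::finite pt) \<Rightarrow> 'n tvec \<Rightarrow> real \<Rightarrow> real set \<Rightarrow> bool" where
  "has_velocity c v t S \<longleftrightarrow>
     (\<exists>g. g t = 0 \<and> (g has_vector_derivative v) (at t within S) \<and>
          (\<forall>\<^sub>F s in at t within S. c s = c t + cover (g s)))"

definition curve_through :: "'n::finite pt set \<Rightarrow> 'n pt \<Rightarrow> 'n tvec \<Rightarrow> (real \<Rightarrow> 'n pt) \<Rightarrow> bool" where
  "curve_through M x v c \<longleftrightarrow>
     c 0 = x \<and> (\<forall>\<^sub>F s in nhds 0. c s \<in> M) \<and> has_velocity c v 0 UNIV"

definition tangent_space :: "'n::finite pt set \<Rightarrow> 'n pt \<Rightarrow> 'n tvec set" where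
  "tangent_space M x = {v. \<exists>c. curve_through M x v c}"

definition tangent_map ::
  "'n::finite pt set \<Rightarrow> ('n pt \<Rightarrow> 'n pt) \<Rightarrow> 'n pt \<Rightarrow> 'n tvec \<Rightarrow> 'n tvec" where
  "tangent_map M f x v = (THE w. \<exists>c. curve_through M x v c \<and> has_velocity (f \<circ> c) w 0 UNIV)"


section \<open>Differential forms on a submanifold\<close>

text \<open>
  A form on a submanifold \<open>M\<close> of \<open>N\<close> is given by a function of which only the values at points
  of \<open>M\<close> and on vectors tangent to \<open>M\<close> matter; thus the restriction to \<open>M\<close> of a form
  on \<open>N\<close> is given by the same function.
\<close>

type_synonym 'n form1 = "'n pt \<Rightarrow> 'n tvec \<Rightarrow> real"
type_synonym 'n form2 = "'n pt \<Rightarrow> 'n tvec \<Rightarrow> 'n tvec \<Rightarrow> real"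

definition wedge :: "'n::finite form1 \<Rightarrow> 'n form1 \<Rightarrow> 'n form2" where
  "wedge \<alpha> \<beta> x v w = \<alpha> x v * \<beta> x w - \<alpha> x w * \<beta> x v"

text \<open>
  The exterior derivative on \<open>M\<close> is the restriction to \<open>M\<close> of the exterior derivative of any
  local extension to \<open>N\<close>.  The extensions are written in the chart of \<open>N\<close> at \<open>x\<close>; they are only
  required to be differentiable at \<open>x\<close>, which suffices for the result on vectors tangent to \<open>M\<close>
  to be independent of the extension.
\<close>

definition ext_deriv0 :: "'n::finite pt set \<Rightarrow> ('n pt \<Rightarrow> real) \<Rightarrow> 'n form1" where
  "ext_deriv0 M f x v =
     (THE a. \<exists>F D. (\<forall>\<^sub>F z in nhds 0. x + cover z \<in> M \<longrightarrow> F z = f (x + cover z)) \<and>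
                   (F has_derivative D) (at 0) \<and> a = D v)"

definition ext_deriv1 :: "'n::finite pt set \<Rightarrow> 'n form1 \<Rightarrow> 'n form2" where
  "ext_deriv1 M \<alpha> x v w =
     (THE a. \<exists>(A :: 'n tvec \<Rightarrow> 'n tvec \<Rightarrow>\<^sub>L real) D.
        (\<forall>\<^sub>F z in nhds 0. x + cover z \<in> M \<longrightarrow>
            (\<forall>u \<in> tangent_space M (x + cover z). blinfun_apply (A z) u = \<alpha> (x + cover z) u)) \<and>
        (A has_derivative D) (at 0) \<and>
        a = blinfun_apply (D v) w - blinfun_apply (D w) v)"

text \<open>The twisted differential \<open>d\<^sub>\<eta> \<alpha> = d\<alpha> - \<eta> \<and> \<alpha>\<close> on functions and on 1-forms.\<close>

definition twisted_deriv0 :: "'n::finite pt set \<Rightarrow> 'n form1 \<Rightarrow> ('n pt \<Rightarrow> real) \<Rightarrow> 'n form1" where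
  "twisted_deriv0 M \<eta> f x v = ext_deriv0 M f x v - f x * \<eta> x v"

definition twisted_deriv1 :: "'n::finite pt set \<Rightarrow> 'n form1 \<Rightarrow> 'n form1 \<Rightarrow> 'n form2" where
  "twisted_deriv1 M \<eta> \<alpha> x v w = ext_deriv1 M \<alpha> x v w - wedge \<eta> \<alpha> x v w"

definition pullback2 :: "'n::finite pt set \<Rightarrow> ('n pt \<Rightarrow> 'n pt) \<Rightarrow> 'n form2 \<Rightarrow> 'n form2" where
  "pullback2 M f \<omega> x v w = \<omega> (f x) (tangent_map M f x v) (tangent_map M f x w)"


section \<open>Hamiltonian flows\<close>

definition hamiltonian_vf ::
  "'n::finite pt set \<Rightarrow> 'n form1 \<Rightarrow> 'n form2 \<Rightarrow> ('n pt \<Rightarrow> real) \<Rightarrow> 'n pt \<Rightarrow> 'n tvec" where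
  "hamiltonian_vf M \<eta> \<omega> H x =
     (THE v. v \<in> tangent_space M x \<and>
             (\<forall>w \<in> tangent_space M x. \<omega> x v w = twisted_deriv0 M \<eta> H x w))"

definition is_flow ::
  "'n::finite pt set \<Rightarrow> ('n pt \<Rightarrow> 'n tvec) \<Rightarrow> (real \<Rightarrow> 'n pt \<Rightarrow> 'n pt) \<Rightarrow> bool" where
  "is_flow M X \<phi> \<longleftrightarrow>
     (\<forall>x \<in> M. \<phi> 0 x = x \<and>
        (\<forall>t. \<phi> t x \<in> M \<and> has_velocity (\<lambda>s. \<phi> s x) (X (\<phi> t x)) t UNIV))"

text \<open>
  The first conjunct guarantees that the definite description in \<open>hamiltonian_vf\<close> is proper;
  on a conformal symplectic manifold it follows from the non-degeneracy of \<open>\<omega>\<close>.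
\<close>

definition is_hamiltonian_flow ::
  "'n::finite pt set \<Rightarrow> 'n form1 \<Rightarrow> 'n form2 \<Rightarrow> ('n pt \<Rightarrow> real) \<Rightarrow> (real \<Rightarrow> 'n pt \<Rightarrow> 'n pt) \<Rightarrow> bool"
  where
  "is_hamiltonian_flow M \<eta> \<omega> H \<phi> \<longleftrightarrow>
     (\<forall>x \<in> M. \<exists>!v. v \<in> tangent_space M x \<and>
             (\<forall>w \<in> tangent_space M x. \<omega> x v w = twisted_deriv0 M \<eta> H x w)) \<and>
     is_flow M (hamiltonian_vf M \<eta> \<omega> H) \<phi>"

definition preserves_form2 ::
  "'n::finite pt set \<Rightarrow> (real \<Rightarrow> 'n pt \<Rightarrow> 'n pt) \<Rightarrow> 'n form2 \<Rightarrow> bool" where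
  "preserves_form2 M \<phi> \<omega> \<longleftrightarrow>
     (\<forall>t. \<forall>x \<in> M. \<forall>v \<in> tangent_space M x. \<forall>w \<in> tangent_space M x.
        pullback2 M (\<phi> t) \<omega> x v w = \<omega> x v w)"


section \<open>Loops\<close>

definition C1_loop :: "(real \<Rightarrow> 'n::finite pt) \<Rightarrow> (real \<Rightarrow> 'n tvec) \<Rightarrow> bool" where
  "C1_loop \<gamma> \<gamma>' \<longleftrightarrow>
     (\<forall>t \<in> {0..1}. has_velocity \<gamma> (\<gamma>' t) t {0..1}) \<and> continuous_on {0..1} \<gamma>' \<and> \<gamma> 0 = \<gamma> 1"

definition loop_integral ::
  "'n::finite form1 \<Rightarrow> (real \<Rightarrow> 'n pt) \<Rightarrow> (real \<Rightarrow> 'n tvec) \<Rightarrow> real" where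
  "loop_integral \<eta> \<gamma> \<gamma>' = integral {0..1} (\<lambda>t. \<eta> (\<gamma> t) (\<gamma>' t))"


section \<open>Conformal symplectization\<close>

definition symplectization :: "'n::finite cotangent set \<Rightarrow> 'n pt set" where
  "symplectization Y = Y \<times> UNIV"

definition d_theta :: "'n::finite form1" where
  "d_theta x = (\<lambda>(u, s). s)"

definition lee_form :: "'n::finite form1" where
  "lee_form x v = - d_theta x v"

text \<open>Pullback along \<open>\<pi> : Y \<times> S\<^sup>1 \<rightarrow> Y\<close>, whose tangent map is the first projection.\<close>

definition pullback_proj :: "('n::finite cotangent \<Rightarrow> 'n cotangent_vec \<Rightarrow> real) \<Rightarrow> 'n form1" where
  "pullback_proj \<alpha> x v = \<alpha> (fst x) (fst v)"

definition conformal_form ::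
  "'n::finite cotangent set \<Rightarrow> ('n cotangent \<Rightarrow> 'n cotangent_vec \<Rightarrow> real) \<Rightarrow> 'n form2" where
  "conformal_form Y \<alpha> x v w =
     - twisted_deriv1 (symplectization Y) lee_form (pullback_proj \<alpha>) x v w"


section \<open>The unit cotangent bundle of the flat torus\<close>

definition unit_torus_bundle :: "'n::finite cotangent set" where
  "unit_torus_bundle = {(q, p). norm p = 1}"

definition liouville_form :: "'n::finite cotangent \<Rightarrow> 'n cotangent_vec \<Rightarrow> real" where
  "liouville_form = (\<lambda>(q, p) (u, v). \<Sum>i\<in>UNIV. p $ i * u $ i)"

end

theory Submission
  imports Defs
begin

text \<open>
  Everything happens in the trivialisation \<open>T N = N \<times> E\<close>, in which a tangent vector is a triple
  \<open>((u, v), s)\<close> of a horizontal part, a momentum part and an \<open>S\<^sup>1\<close> part.  The manifold \<open>M\<close> is cut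
  out by \<open>\<parallel>p\<parallel> = 1\<close>, so its tangent space at \<open>((q, p), \<theta>)\<close> is \<open>p \<bullet> v = 0\<close>: differentiating
  \<open>p \<bullet> p = 1\<close> along a curve gives one inclusion, great circles on the sphere give the other.

  The real work is that exterior derivatives on \<open>M\<close> may be computed from any extension to \<open>N\<close>.
  For functions this is the chain rule along a great circle.  For 1-forms, let \<open>B\<close> be the
  difference of two extensions, with derivative \<open>D\<close> at the base point.  Differentiating
  \<open>B (W) = 0\<close> in the direction \<open>v\<close>, where \<open>W\<close> is the orthogonal projection of a constant vector \<open>w\<close>
  to the tangent spaces of \<open>M\<close>, gives \<open>D v w = (v \<bullet> w) B (p)\<close>, with the inner product taken on
  momentum parts: this is the second fundamental form of the sphere.  It is symmetric,
  hence drops out of \<open>D v w - D w v\<close>.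

  With the affine extensions of \<open>p \<bullet> dq\<close> and \<open>p\<^sub>k\<close> one then finds, for
  \<open>a = ((u, v), s)\<close> and \<open>a' = ((u', v'), s')\<close>,
  \<open>\<omega>(a, a') = v' \<bullet> u - v \<bullet> u' - s (p \<bullet> u') + s' (p \<bullet> u)\<close> and
  \<open>d\<^sub>\<eta> H (a') = v'\<^sub>k + p\<^sub>k s'\<close>, so that \<open>\<partial>/\<partial>q\<^sub>k\<close> is the Hamiltonian vector field; it is the only
  one since \<open>\<omega>\<close> is non-degenerate.  Its flow consists of translations, which have identity
  tangent maps and do not change \<open>p\<close>, the only coordinate on which \<open>\<omega>\<close> depends.  Finally, if
  \<open>n \<ge> 2\<close> there is a unit covector \<open>p\<close> with \<open>p\<^sub>k = 0\<close>, and the \<open>S\<^sup>1\<close> factor over it is a loop in the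
  zero level on which \<open>-d\<theta>\<close> has integral \<open>-1\<close>.
\<close>

section \<open>Velocities\<close>

lemma circle_of_add: "circle_of (a + b) = circle_of a + circle_of b"
  by (simp add: plus_circle.abs_eq)

lemma circle_of_0: "circle_of 0 = 0"
  by (simp add: zero_circle_def)

lemma circle_of_eq_iff: "circle_of a = circle_of b \<longleftrightarrow> a - b \<in> \<int>"
  by (rule circle.abs_eq_iff)

lemma cover_eq: "cover z = ((\<chi> i. circle_of (fst (fst z) $ i), snd (fst z)), circle_of (snd z))"
  by (simp add: cover_def split: prod.splits)

lemma cover_0: "cover 0 = 0"
  by (simp add: cover_eq circle_of_0 zero_prod_def zero_vec_def)

lemma cover_add: "cover (a + b) = cover a + cover b"
  by (simp add: cover_eq circle_of_add prod_eq_iff vec_eq_iff)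

lemma cover_diff: "cover (a - b) = cover a - cover b"
  using cover_add[of "a - b" b] by simp

lemma cover_eq_0_imp_eq_0:
  assumes "cover z = 0" "norm z < 1"
  shows "z = 0"
proof -
  obtain u v s where z: "z = ((u, v), s)" by (metis prod.exhaust)
  have int0: "a = 0" if "circle_of a = 0" "\<bar>a\<bar> < 1" for a
    using that circle_of_eq_iff[of a 0] by (auto simp: circle_of_0 elim!: Ints_cases)
  have le: "norm (u, v) \<le> norm z" "norm s \<le> norm z" "norm u \<le> norm (u, v)"
    unfolding z using norm_fst_le[of "(u, v)" s] norm_snd_le[of s "(u, v)"] norm_fst_le[of u v]
    by auto
  have "u $ i = 0" for i
  proof (rule int0)
    show "circle_of (u $ i) = 0"
      using assms(1) by (simp add: z cover_eq prod_eq_iff vec_eq_iff)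
    show "\<bar>u $ i\<bar> < 1" using component_le_norm_cart[of u i] le assms(2) by linarith
  qed
  moreover have "s = 0"
    by (rule int0) (use assms le in \<open>auto simp: z cover_eq prod_eq_iff\<close>)
  moreover have "v = 0" using assms(1) by (simp add: z cover_eq prod_eq_iff)
  ultimately show ?thesis by (simp add: z vec_eq_iff prod_eq_iff)
qed

lemma vector_derivative_unique_eventually:
  assumes f: "(f has_vector_derivative v) (at t)" and g: "(g has_vector_derivative w) (at t)"
    and "\<forall>\<^sub>F s in at t. f s = g s" "f t = g t"
  shows "v = w"
proof -
  have "(g has_vector_derivative v) (at t)"
    using f assms(3,4) unfolding has_vector_derivative_def
    by (rule has_derivative_transform_eventually) simp
  then show ?thesis using g by (rule vector_derivative_unique_at)
qed

text \<open>
  Two expressions of a curve in the chart differ by a continuous function with values in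
  the deck group, which is discrete.
\<close>

lemma has_velocity_unique:
  assumes "has_velocity c v t UNIV" "has_velocity c w t UNIV"
  shows "v = w"
proof -
  obtain g where g: "g t = 0" "(g has_vector_derivative v) (at t)"
    "\<forall>\<^sub>F s in at t. c s = c t + cover (g s)"
    using assms(1) by (auto simp: has_velocity_def)
  obtain h where h: "h t = 0" "(h has_vector_derivative w) (at t)"
    "\<forall>\<^sub>F s in at t. c s = c t + cover (h s)"
    using assms(2) by (auto simp: has_velocity_def)
  have d: "((\<lambda>s. g s - h s) has_vector_derivative (v - w)) (at t)"
    by (intro has_vector_derivative_diff g h)
  have "isCont (\<lambda>s. g s - h s) t"
    using d by (rule has_vector_derivative_continuous)
  then have "((\<lambda>s. g s - h s) \<longlongrightarrow> 0) (at t)"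
    by (simp add: isCont_def g h)
  then have "\<forall>\<^sub>F s in at t. norm (g s - h s) < 1"
    by (auto simp: tendsto_iff dest: spec[of _ 1])
  with g(3) h(3) have "\<forall>\<^sub>F s in at t. g s = h s"
  proof eventually_elim
    case (elim s)
    then have "cover (g s - h s) = 0" by (simp add: cover_diff)
    then show ?case using elim cover_eq_0_imp_eq_0[of "g s - h s"] by simp
  qed
  then show ?thesis
    by (rule vector_derivative_unique_eventually[OF g(2) h(2)]) (simp add: g h)
qed

lemma has_velocity_cover:
  assumes "g t = 0" "(g has_vector_derivative v) (at t within S)"
    and "\<And>s. c s = c t + cover (g s)"
  shows "has_velocity c v t S"
  unfolding has_velocity_def
  by (intro exI[of _ g] conjI always_eventually allI) (fact assms)+

lemma curve_through_cover:
  assumes "z 0 = 0" "(z has_vector_derivative v) (at 0)" "\<And>s. x + cover (z s) \<in> M"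
  shows "curve_through M x v (\<lambda>s. x + cover (z s))"
  unfolding curve_through_def
  using assms by (auto simp: cover_0 intro!: has_velocity_cover[of z])

text \<open>
  The chart expression of \<open>f \<circ> c\<close> is that of \<open>c\<close>.  Since this holds for every curve \<open>c\<close> with
  velocity \<open>v\<close>, the definite description of the tangent map is proper.
\<close>

lemma tangent_map_translation:
  assumes f: "\<And>x z. f (x + cover z) = f x + cover z" and v: "v \<in> tangent_space M x"
  shows "tangent_map M f x v = v"
proof -
  have vel: "has_velocity (f \<circ> c) v 0 UNIV" if c: "has_velocity c v 0 UNIV" for c
  proof -
    obtain g where "g 0 = 0" "(g has_vector_derivative v) (at 0)"
      "\<forall>\<^sub>F s in at 0. c s = c 0 + cover (g s)"
      using c by (auto simp: has_velocity_def)
    then show ?thesis unfolding has_velocity_def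
      by (intro exI[of _ g]) (auto simp: f elim!: eventually_mono)
  qed
  obtain c where c: "curve_through M x v c"
    using v by (auto simp: tangent_space_def)
  show ?thesis unfolding tangent_map_def
  proof (rule the_equality)
    show "\<exists>c. curve_through M x v c \<and> has_velocity (f \<circ> c) v 0 UNIV"
      using c vel by (auto simp: curve_through_def)
  next
    fix w assume "\<exists>c. curve_through M x v c \<and> has_velocity (f \<circ> c) w 0 UNIV"
    then obtain c where "has_velocity c v 0 UNIV" "has_velocity (f \<circ> c) w 0 UNIV"
      by (auto simp: curve_through_def)
    then show "w = v" using vel has_velocity_unique by blast
  qed
qed

section \<open>Tangent spaces of the symplectization of the unit bundle\<close>

abbreviation horizontal :: "('a \<times> 'b) \<times> 'c \<Rightarrow> 'a" where
  "horizontal a \<equiv> fst (fst a)"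

abbreviation momentum :: "('a \<times> 'b) \<times> 'c \<Rightarrow> 'b" where
  "momentum a \<equiv> snd (fst a)"

abbreviation unit_symplectization :: "'n::finite pt set" where
  "unit_symplectization \<equiv> symplectization unit_torus_bundle"

lemma mem_unit_symplectization: "x \<in> unit_symplectization \<longleftrightarrow> norm (momentum x) = 1"
  by (cases x) (auto simp: symplectization_def unit_torus_bundle_def mem_Times_iff split: prod.splits)

lemma momentum_cover: "momentum (cover z) = momentum z"
  by (simp add: cover_eq)

text \<open>
  The curve is a straight line in the \<open>q\<close> and \<open>\<theta>\<close> directions and a great circle in the momentum
  direction.
\<close>

lemma exists_lifted_curve:
  fixes x :: "'n::finite pt" and v :: "'n tvec"
  assumes x: "x \<in> unit_symplectization" and v: "momentum x \<bullet> momentum v = 0"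
  obtains z where "z 0 = 0" "(z has_vector_derivative v) (at 0)"
    "\<And>s. x + cover (z s) \<in> unit_symplectization"
proof
  define p where "p = momentum x"
  define b where "b = momentum v"
  define r where "r = norm b"
  define P where "P s = cos (s * r) *\<^sub>R p + sin (s * r) *\<^sub>R (inverse r *\<^sub>R b)" for s
  define z :: "real \<Rightarrow> 'n tvec" where
    "z s = ((s *\<^sub>R horizontal v, P s - p), s * snd v)" for s
  have pp: "p \<bullet> p = 1" using x by (simp add: mem_unit_symplectization p_def norm_eq_1)
  have pb: "p \<bullet> b = 0" "b \<bullet> p = 0" using v by (simp_all add: p_def b_def inner_commute)
  have bb: "b \<bullet> b = r * r" by (simp add: r_def power2_norm_eq_inner flip: power2_eq_square)
  \<comment> \<open>For \<open>b = 0\<close> the quotient \<open>inverse 0\<close> is \<open>0\<close> and the great circle is constant.\<close>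
  have rb: "(r * inverse r) *\<^sub>R b = b" by (cases "b = 0") (simp_all add: r_def)
  show "z 0 = 0" by (simp add: z_def P_def zero_prod_def)
  have "(P has_vector_derivative b) (at 0)"
    unfolding P_def
    by (auto intro!: derivative_eq_intros
        simp: rb has_real_derivative_iff_has_vector_derivative[symmetric])
  then show "(z has_vector_derivative v) (at 0)"
    unfolding z_def
    by (auto intro!: derivative_eq_intros has_vector_derivative_Pair
        simp: b_def has_real_derivative_iff_has_vector_derivative[symmetric])
  fix s
  have "P s \<bullet> P s = 1"
  proof (cases "r = 0")
    case True
    then show ?thesis by (simp add: P_def pp)
  next
    case False
    define e where "e = inverse r *\<^sub>R b"
    have "e \<bullet> e = 1" "p \<bullet> e = 0" "e \<bullet> p = 0" 
      using False by (simp_all add: e_def bb pb field_simps)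
    then have "P s \<bullet> P s = cos (s * r) * cos (s * r) + sin (s * r) * sin (s * r)"
      unfolding P_def e_def[symmetric] by (simp add: inner_add_left inner_add_right pp)
    then show ?thesis using sin_cos_squared_add3[of "s * r"] by simp
  qed
  then show "x + cover (z s) \<in> unit_symplectization"
    by (simp add: mem_unit_symplectization momentum_cover z_def p_def[symmetric] norm_eq_1)
qed

lemma tangent_space_unit_symplectization:
  fixes x :: "'n::finite pt"
  assumes x: "x \<in> unit_symplectization"
  shows "tangent_space unit_symplectization x = {v. momentum x \<bullet> momentum v = 0}"
proof (intro equalityI subsetI CollectI)
  fix v :: "'n tvec" assume "v \<in> {v. momentum x \<bullet> momentum v = 0}"
  then obtain z where "z 0 = 0" "(z has_vector_derivative v) (at 0)"
    "\<And>s. x + cover (z s) \<in> unit_symplectization"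
    using exists_lifted_curve[OF x] by blast
  from curve_through_cover[OF this] show "v \<in> tangent_space unit_symplectization x"
    by (auto simp: tangent_space_def)
next
  fix v assume "v \<in> tangent_space unit_symplectization x"
  then obtain c where "curve_through unit_symplectization x v c"
    by (auto simp: tangent_space_def)
  then obtain g where c: "c 0 = x" "\<forall>\<^sub>F s in nhds 0. c s \<in> unit_symplectization"
    and g: "g 0 = 0" "(g has_vector_derivative v) (at 0)"
      "\<forall>\<^sub>F s in at 0. c s = c 0 + cover (g s)"
    by (auto simp: curve_through_def has_velocity_def)
  define Q where "Q s = momentum x + momentum (g s)" for s
  have Q': "(Q has_vector_derivative momentum v) (at 0)"
    unfolding Q_def
    using bounded_linear.has_vector_derivative[OF
      bounded_linear_compose[OF bounded_linear_snd bounded_linear_fst] g(2)]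
    by (auto intro!: derivative_eq_intros)
  have Q0: "Q 0 = momentum x" by (simp add: Q_def g)
  have d: "((\<lambda>s. Q s \<bullet> Q s) has_vector_derivative
      (Q 0 \<bullet> momentum v + momentum v \<bullet> Q 0)) (at 0)"
    by (rule bounded_bilinear.has_vector_derivative[OF bounded_bilinear_inner Q' Q'])
  have ev: "\<forall>\<^sub>F s in at 0. Q s \<bullet> Q s = 1"
    using g(3) c(2)[unfolded eventually_nhds_conv_at, THEN conjunct1]
  proof eventually_elim
    case (elim s)
    then show ?case
      by (simp add: c(1) mem_unit_symplectization momentum_cover Q_def norm_eq_1)
  qed
  have "Q 0 \<bullet> Q 0 = 1" using x by (simp add: Q0 mem_unit_symplectization norm_eq_1)
  then have "Q 0 \<bullet> momentum v + momentum v \<bullet> Q 0 = 0"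
    by (intro vector_derivative_unique_eventually[OF d has_vector_derivative_const ev])
  then show "momentum x \<bullet> momentum v = 0" by (simp add: Q0 inner_commute)
qed

section \<open>Exterior derivatives from an extension\<close>

lemma eventually_along_curve:
  fixes z :: "real \<Rightarrow> 'a::real_normed_vector"
  assumes "\<forall>\<^sub>F y in nhds 0. P y" "z 0 = 0" "(z has_vector_derivative v) (at 0)"
  shows "\<forall>\<^sub>F s in at 0. P (z s)"
proof -
  have "(z \<longlongrightarrow> 0) (at 0)"
    using has_vector_derivative_continuous[OF assms(3)] by (simp add: isCont_def assms(2))
  then show ?thesis using assms(1) by (simp add: filterlim_iff)
qed

text \<open>
  Two extensions agree along a curve in \<open>M\<close> with velocity \<open>v\<close>, hence so do their derivatives
  in the direction \<open>v\<close>.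
\<close>

lemma ext_deriv0_unit_symplectization:
  assumes x: "x \<in> unit_symplectization" and v: "momentum x \<bullet> momentum v = 0"
    and ext: "\<forall>\<^sub>F z in nhds 0. x + cover z \<in> unit_symplectization \<longrightarrow> F z = f (x + cover z)"
    and F: "(F has_derivative D) (at 0)"
  shows "ext_deriv0 unit_symplectization f x v = D v"
  unfolding ext_deriv0_def
proof (rule the_equality)
  show "\<exists>F D'. (\<forall>\<^sub>F z in nhds 0. x + cover z \<in> unit_symplectization \<longrightarrow> F z = f (x + cover z)) \<and>
      (F has_derivative D') (at 0) \<and> D v = D' v"
    using ext F by blast
next
  fix a
  assume "\<exists>F D. (\<forall>\<^sub>F z in nhds 0. x + cover z \<in> unit_symplectization \<longrightarrow> F z = f (x + cover z)) \<and>
      (F has_derivative D) (at 0) \<and> a = D v"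
  then obtain G D' where
    G: "\<forall>\<^sub>F z in nhds 0. x + cover z \<in> unit_symplectization \<longrightarrow> G z = f (x + cover z)"
      "(G has_derivative D') (at 0)" and a: "a = D' v" by blast
  obtain z where z: "z 0 = 0" "(z has_vector_derivative v) (at 0)"
    "\<And>s. x + cover (z s) \<in> unit_symplectization"
    using exists_lifted_curve[OF x v] by blast
  have chain: "((\<lambda>s. K (z s)) has_vector_derivative L v) (at 0)"
    if "(K has_derivative L) (at 0)" for K :: "_ \<Rightarrow> real" and L
  proof -
    have "(K has_derivative L) (at (z 0) within range z)"
      using that by (simp add: z(1) has_derivative_at_withinI)
    from vector_derivative_diff_chain_within[OF z(2) this] show ?thesis by (simp add: o_def)
  qed
  have "\<forall>\<^sub>F s in at 0. F (z s) = G (z s)"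
    using eventually_along_curve[OF ext z(1,2)] eventually_along_curve[OF G(1) z(1,2)]
    by eventually_elim (simp add: z(3))
  moreover have "F (z 0) = G (z 0)"
    using eventually_nhds_x_imp_x[OF ext] eventually_nhds_x_imp_x[OF G(1)] z(3)[of 0]
    by (simp add: z(1))
  ultimately show "a = D v"
    unfolding a by (rule vector_derivative_unique_eventually[OF chain[OF F] chain[OF G(2)], symmetric])
qed

text \<open>
  The second fundamental form of the unit sphere: along a great circle with
  velocity \<open>v\<close>, the vector field \<open>W\<close> obtained by projecting \<open>w\<close> orthogonally to the tangent
  spaces has derivative \<open>-(v \<bullet> w) p\<close> at the base point \<open>p\<close>, and \<open>B (W) = 0\<close> throughout.
\<close>

lemma derivative_of_form_vanishing_on_tangent_vectors:
  fixes x :: "'n::finite pt" and B :: "'n tvec \<Rightarrow> 'n tvec \<Rightarrow>\<^sub>L real"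
  assumes x: "x \<in> unit_symplectization"
    and v: "momentum x \<bullet> momentum v = 0" and w: "momentum x \<bullet> momentum w = 0"
    and vanish: "\<forall>\<^sub>F z in nhds 0. x + cover z \<in> unit_symplectization \<longrightarrow>
      (\<forall>u \<in> tangent_space unit_symplectization (x + cover z). blinfun_apply (B z) u = 0)"
    and B: "(B has_derivative D) (at 0)"
  shows "blinfun_apply (D v) w =
    (momentum v \<bullet> momentum w) * blinfun_apply (B 0) ((0, momentum x), 0)"
proof -
  obtain z where z: "z 0 = 0" "(z has_vector_derivative v) (at 0)"
    "\<And>s. x + cover (z s) \<in> unit_symplectization"
    using exists_lifted_curve[OF x v] by blast
  define P where "P s = momentum x + momentum (z s)" for s
  define W :: "real \<Rightarrow> 'n tvec" where
    "W s = w - ((0, (P s \<bullet> momentum w) *\<^sub>R P s), 0)" for s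
  have P0: "P 0 = momentum x" by (simp add: P_def z)
  have PP: "P s \<bullet> P s = 1" for s
    using z(3)[of s] by (simp add: mem_unit_symplectization momentum_cover P_def norm_eq_1)
  have P': "(P has_vector_derivative momentum v) (at 0)"
    unfolding P_def
    using bounded_linear.has_vector_derivative[OF
      bounded_linear_compose[OF bounded_linear_snd bounded_linear_fst] z(2)]
    by (auto intro!: derivative_eq_intros)
  have "((\<lambda>s. P s \<bullet> momentum w) has_vector_derivative momentum v \<bullet> momentum w) (at 0)"
    by (rule bounded_linear.has_vector_derivative[OF bounded_linear_inner_left P'])
  from bounded_bilinear.has_vector_derivative[OF bounded_bilinear_scaleR this P']
  have "((\<lambda>s. (P s \<bullet> momentum w) *\<^sub>R P s) has_vector_derivative
      (momentum v \<bullet> momentum w) *\<^sub>R momentum x) (at 0)"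
    by (simp add: P0 w)
  then have "(W has_vector_derivative
      0 - ((0, (momentum v \<bullet> momentum w) *\<^sub>R momentum x), 0)) (at 0)"
    unfolding W_def
    by (intro has_vector_derivative_diff has_vector_derivative_const has_vector_derivative_Pair)
  then have W': "(W has_vector_derivative
      - (momentum v \<bullet> momentum w) *\<^sub>R ((0, momentum x), 0)) (at 0)"
    by (simp add: prod_eq_iff)
  have W0: "W 0 = w" by (simp add: W_def P0 w flip: zero_prod_def)
  have W_tangent: "W s \<in> tangent_space unit_symplectization (x + cover (z s))" for s
    by (simp add: tangent_space_unit_symplectization[OF z(3)] momentum_cover
        P_def[symmetric] W_def inner_diff_right PP)
  have "(B has_derivative D) (at (z 0) within range z)"
    using B by (simp add: z(1) has_derivative_at_withinI)
  from vector_derivative_diff_chain_within[OF z(2) this]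
  have Bz: "((\<lambda>s. B (z s)) has_vector_derivative D v) (at 0)" by (simp add: o_def)
  have d: "((\<lambda>s. blinfun_apply (B (z s)) (W s)) has_vector_derivative
      (blinfun_apply (B (z 0)) (- (momentum v \<bullet> momentum w) *\<^sub>R ((0, momentum x), 0)) +
       blinfun_apply (D v) (W 0))) (at 0)"
    by (rule bounded_bilinear.has_vector_derivative[OF bounded_bilinear_blinfun_apply Bz W'])
  have ev: "\<forall>\<^sub>F s in at 0. blinfun_apply (B (z s)) (W s) = 0"
    using eventually_along_curve[OF vanish z(1,2)]
    by eventually_elim (use z(3) W_tangent in blast)
  have "blinfun_apply (B (z 0)) (W 0) = 0"
    using eventually_nhds_x_imp_x[OF vanish] z(3)[of 0] W_tangent[of 0] by (simp add: z(1))
  then have "blinfun_apply (B (z 0)) (- (momentum v \<bullet> momentum w) *\<^sub>R ((0, momentum x), 0)) +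
       blinfun_apply (D v) (W 0) = 0"
    by (intro vector_derivative_unique_eventually[OF d has_vector_derivative_const ev])
  then show ?thesis
    by (simp only: z(1) W0 blinfun.scaleR_right) simp
qed

text \<open>
  For the difference of two extensions the previous lemma gives an expression symmetric
  in \<open>v\<close> and \<open>w\<close>, so antisymmetrisation removes it.
\<close>

lemma ext_deriv1_unit_symplectization:
  fixes x :: "'n::finite pt" and A :: "'n tvec \<Rightarrow> 'n tvec \<Rightarrow>\<^sub>L real"
  assumes x: "x \<in> unit_symplectization"
    and v: "momentum x \<bullet> momentum v = 0" and w: "momentum x \<bullet> momentum w = 0"
    and ext: "\<forall>\<^sub>F z in nhds 0. x + cover z \<in> unit_symplectization \<longrightarrow>
      (\<forall>u \<in> tangent_space unit_symplectization (x + cover z).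
         blinfun_apply (A z) u = \<alpha> (x + cover z) u)"
    and A: "(A has_derivative D) (at 0)"
  shows "ext_deriv1 unit_symplectization \<alpha> x v w =
    blinfun_apply (D v) w - blinfun_apply (D w) v"
  unfolding ext_deriv1_def
proof (rule the_equality)
  show "\<exists>(A :: 'n tvec \<Rightarrow> 'n tvec \<Rightarrow>\<^sub>L real) D'.
      (\<forall>\<^sub>F z in nhds 0. x + cover z \<in> unit_symplectization \<longrightarrow>
         (\<forall>u \<in> tangent_space unit_symplectization (x + cover z).
            blinfun_apply (A z) u = \<alpha> (x + cover z) u)) \<and>
      (A has_derivative D') (at 0) \<and>
      blinfun_apply (D v) w - blinfun_apply (D w) v =
        blinfun_apply (D' v) w - blinfun_apply (D' w) v"
    using ext A by blast
next
  fix a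
  assume "\<exists>(A :: 'n tvec \<Rightarrow> 'n tvec \<Rightarrow>\<^sub>L real) D.
      (\<forall>\<^sub>F z in nhds 0. x + cover z \<in> unit_symplectization \<longrightarrow>
         (\<forall>u \<in> tangent_space unit_symplectization (x + cover z).
            blinfun_apply (A z) u = \<alpha> (x + cover z) u)) \<and>
      (A has_derivative D) (at 0) \<and> a = blinfun_apply (D v) w - blinfun_apply (D w) v"
  then obtain A' :: "'n tvec \<Rightarrow> 'n tvec \<Rightarrow>\<^sub>L real" and D' where
    ext': "\<forall>\<^sub>F z in nhds 0. x + cover z \<in> unit_symplectization \<longrightarrow>
      (\<forall>u \<in> tangent_space unit_symplectization (x + cover z).
         blinfun_apply (A' z) u = \<alpha> (x + cover z) u)"
    and A': "(A' has_derivative D') (at 0)"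
    and a: "a = blinfun_apply (D' v) w - blinfun_apply (D' w) v" by blast
  have vanish: "\<forall>\<^sub>F z in nhds 0. x + cover z \<in> unit_symplectization \<longrightarrow>
      (\<forall>u \<in> tangent_space unit_symplectization (x + cover z). blinfun_apply (A' z - A z) u = 0)"
    using ext ext' by eventually_elim (simp add: blinfun.diff_left)
  have d: "((\<lambda>z. A' z - A z) has_derivative (\<lambda>z. D' z - D z)) (at 0)"
    by (intro has_derivative_diff A A')
  have "blinfun_apply (D' v - D v) w = blinfun_apply (D' w - D w) v"
    using derivative_of_form_vanishing_on_tangent_vectors[OF x v w vanish d]
      derivative_of_form_vanishing_on_tangent_vectors[OF x w v vanish d]
    by (simp add: inner_commute)
  then show "a = blinfun_apply (D v) w - blinfun_apply (D w) v"
    by (simp add: a blinfun.diff_left)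
qed

section \<open>The conformal form and the Hamiltonian vector field\<close>

lemma liouville_eq: "pullback_proj liouville_form x u = momentum x \<bullet> horizontal u"
  by (simp add: pullback_proj_def liouville_form_def inner_vec_def split: prod.splits)

lemma ext_deriv1_liouville:
  fixes x :: "'n::finite pt"
  assumes x: "x \<in> unit_symplectization"
    and v: "momentum x \<bullet> momentum v = 0" and w: "momentum x \<bullet> momentum w = 0"
  shows "ext_deriv1 unit_symplectization (pullback_proj liouville_form) x v w =
    momentum v \<bullet> horizontal w - momentum w \<bullet> horizontal v"
proof -
  define L :: "real ^ 'n \<Rightarrow> 'n tvec \<Rightarrow>\<^sub>L real" where
    "L p = blinfun_inner_left p o\<^sub>L (Blinfun fst o\<^sub>L Blinfun fst)" for p
  have L: "blinfun_apply (L p) u = p \<bullet> horizontal u" for p u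
    by (simp add: L_def bounded_linear_Blinfun_apply bounded_linear_fst inner_commute)
  have "bounded_linear L"
    unfolding L_def by (intro bounded_linear_intros)
  moreover have "((\<lambda>z :: 'n tvec. momentum x + momentum z) has_derivative
      (\<lambda>z. 0 + momentum z)) (at 0)"
    by (intro has_derivative_add has_derivative_const bounded_linear_imp_has_derivative
        bounded_linear_intros bounded_linear_ident)
  ultimately have "((\<lambda>z :: 'n tvec. L (momentum x + momentum z)) has_derivative
      (\<lambda>z. L (0 + momentum z))) (at 0)"
    by (rule bounded_linear.has_derivative)
  then have "ext_deriv1 unit_symplectization (pullback_proj liouville_form) x v w =
      blinfun_apply (L (0 + momentum v)) w - blinfun_apply (L (0 + momentum w)) v"
    by (intro ext_deriv1_unit_symplectization[OF x v w] always_eventually allI impI ballI)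
      (simp_all add: L liouville_eq momentum_cover)
  then show ?thesis by (simp add: L)
qed

lemma conformal_form_eq:
  assumes x: "x \<in> unit_symplectization"
    and v: "momentum x \<bullet> momentum v = 0" and w: "momentum x \<bullet> momentum w = 0"
  shows "conformal_form unit_torus_bundle liouville_form x v w =
    momentum w \<bullet> horizontal v - momentum v \<bullet> horizontal w
    - snd v * (momentum x \<bullet> horizontal w) + snd w * (momentum x \<bullet> horizontal v)"
  by (simp add: conformal_form_def twisted_deriv1_def ext_deriv1_liouville[OF assms] wedge_def
      lee_form_def d_theta_def liouville_eq split: prod.splits)

lemma twisted_deriv0_momentum:
  fixes x :: "'n::finite pt"
  assumes x: "x \<in> unit_symplectization" and w: "momentum x \<bullet> momentum w = 0"
  shows "twisted_deriv0 unit_symplectization lee_form (\<lambda>x. momentum x $ k) x w =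
    momentum w $ k + momentum x $ k * snd w"
proof -
  have "((\<lambda>z :: 'n tvec. momentum x $ k + momentum z $ k) has_derivative
      (\<lambda>z. 0 + momentum z $ k)) (at 0)"
    by (intro has_derivative_add has_derivative_const bounded_linear_imp_has_derivative
        bounded_linear_compose[OF bounded_linear_vec_nth]
        bounded_linear_compose[OF bounded_linear_snd bounded_linear_fst])
  then have "ext_deriv0 unit_symplectization (\<lambda>x. momentum x $ k) x w = 0 + momentum w $ k"
    by (intro ext_deriv0_unit_symplectization[OF x w] always_eventually allI impI)
      (simp_all add: momentum_cover)
  then show ?thesis
    by (simp add: twisted_deriv0_def lee_form_def d_theta_def split: prod.splits)
qed

text \<open>
  Non-degeneracy: testing against \<open>\<partial>/\<partial>\<theta>\<close> and against momentum directions kills the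
  horizontal part of \<open>v\<close>, and testing against horizontal directions gives
  \<open>momentum v = - snd v *\<^sub>R p\<close>, which is both tangent and normal to the sphere.  The form is
  written out in coordinates because there its linearity in \<open>v\<close>, needed to apply the lemma to a
  difference of two vectors, is evident.
\<close>

lemma conformal_form_nondegenerate:
  fixes x :: "'n::finite pt" and v :: "'n tvec"
  assumes x: "x \<in> unit_symplectization" and v: "momentum x \<bullet> momentum v = 0"
    and zero: "\<And>w :: 'n tvec. momentum x \<bullet> momentum w = 0 \<Longrightarrow>
      momentum w \<bullet> horizontal v - momentum v \<bullet> horizontal w
      - snd v * (momentum x \<bullet> horizontal w) + snd w * (momentum x \<bullet> horizontal v) = 0"
  shows "v = 0"
proof -
  have xx: "momentum x \<bullet> momentum x = 1"
    using x by (simp add: mem_unit_symplectization norm_eq_1)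
  have xu: "momentum x \<bullet> horizontal v = 0"
    using zero[of "((0, 0), 1)"] by simp
  then have u: "horizontal v = 0"
    using zero[of "((0, horizontal v), 0)"] by simp
  have "(momentum v + snd v *\<^sub>R momentum x) \<bullet> y = 0" for y
    using zero[of "((y, 0), 0)"] by (simp add: inner_add_left algebra_simps)
  then have mv: "momentum v + snd v *\<^sub>R momentum x = 0"
    by (metis inner_eq_zero_iff)
  then have "momentum x \<bullet> (momentum v + snd v *\<^sub>R momentum x) = 0" by simp
  then have "snd v = 0" by (simp add: inner_add_right v xx)
  with mv u show ?thesis by (simp add: prod_eq_iff)
qed

lemma hamiltonian_direction:
  fixes x :: "'n::finite pt" and v :: "'n tvec"
  assumes x: "x \<in> unit_symplectization"
  shows "(v \<in> tangent_space unit_symplectization x \<and>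
      (\<forall>w \<in> tangent_space unit_symplectization x.
         conformal_form unit_torus_bundle liouville_form x v w =
         twisted_deriv0 unit_symplectization lee_form (\<lambda>x. momentum x $ k) x w)) \<longleftrightarrow>
    v = ((axis k 1, 0), 0)" (is "?L \<longleftrightarrow> v = ?e")
proof
  assume "v = ?e"
  then show ?L
    by (auto simp: tangent_space_unit_symplectization[OF x] conformal_form_eq[OF x]
        twisted_deriv0_momentum[OF x] inner_axis)
next
  assume L: ?L
  then have v: "momentum x \<bullet> momentum v = 0"
    by (simp add: tangent_space_unit_symplectization[OF x])
  have "v - ?e = 0"
  proof (rule conformal_form_nondegenerate[OF x])
    show "momentum x \<bullet> momentum (v - ?e) = 0" using v by simp
    fix w :: "'n tvec" assume w: "momentum x \<bullet> momentum w = 0"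
    then have "w \<in> tangent_space unit_symplectization x"
      by (simp add: tangent_space_unit_symplectization[OF x])
    with L have "conformal_form unit_torus_bundle liouville_form x v w =
         twisted_deriv0 unit_symplectization lee_form (\<lambda>x. momentum x $ k) x w"
      by blast
    then show "momentum w \<bullet> horizontal (v - ?e) - momentum (v - ?e) \<bullet> horizontal w
        - snd (v - ?e) * (momentum x \<bullet> horizontal w)
        + snd w * (momentum x \<bullet> horizontal (v - ?e)) = 0"
      using v w by (simp add: conformal_form_eq[OF x] twisted_deriv0_momentum[OF x] inner_axis
          inner_diff_right algebra_simps)
  qed
  then show "v = ?e" by simp
qed

section \<open>The flow and the loop\<close>

lemma hamiltonian_flow_momentum:
  fixes \<phi> :: "real \<Rightarrow> 'n::finite pt \<Rightarrow> 'n pt"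
  assumes \<phi>: "\<And>t x. \<phi> t x = x + cover ((axis k t, 0), 0)"
  shows "is_hamiltonian_flow unit_symplectization lee_form
    (conformal_form unit_torus_bundle liouville_form) (\<lambda>x. momentum x $ k) \<phi>"
proof -
  have vf: "hamiltonian_vf unit_symplectization lee_form
      (conformal_form unit_torus_bundle liouville_form) (\<lambda>x. momentum x $ k) x =
      ((axis k 1, 0), 0)" if "x \<in> unit_symplectization" for x :: "'n pt"
    unfolding hamiltonian_vf_def hamiltonian_direction[OF that] by simp
  have mem: "\<phi> t x \<in> unit_symplectization" if "x \<in> unit_symplectization" for t x
    using that by (simp add: \<phi> mem_unit_symplectization momentum_cover)
  have vel: "has_velocity (\<lambda>s. \<phi> s x) ((axis k 1, 0), 0) t UNIV" for t x
  proof (rule has_velocity_cover[where g = "\<lambda>s. (s - t) *\<^sub>R ((axis k 1, 0), 0)"])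
    show "(t - t) *\<^sub>R ((axis k 1, 0), 0) = (0 :: 'n tvec)" by (simp add: zero_prod_def)
    show "((\<lambda>s. (s - t) *\<^sub>R ((axis k 1, 0), 0) :: 'n tvec) has_vector_derivative
        ((axis k 1, 0), 0)) (at t)"
      by (auto intro!: derivative_eq_intros
          simp: has_real_derivative_iff_has_vector_derivative[symmetric])
    have line: "((axis k s, 0), 0) = ((axis k t, 0), 0) + (s - t) *\<^sub>R (((axis k 1, 0), 0) :: 'n tvec)" for s
      by (simp add: axis_def vec_eq_iff)
    show "\<phi> s x = \<phi> t x + cover ((s - t) *\<^sub>R ((axis k 1, 0), 0))" for s
      unfolding \<phi> line[of s] cover_add by (rule add.assoc[symmetric])
  qed
  show ?thesis
    unfolding is_hamiltonian_flow_def is_flow_def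
  proof (intro conjI ballI allI)
    fix x :: "'n pt" assume x: "x \<in> unit_symplectization"
    show "\<exists>!v. v \<in> tangent_space unit_symplectization x \<and>
        (\<forall>w \<in> tangent_space unit_symplectization x.
           conformal_form unit_torus_bundle liouville_form x v w =
           twisted_deriv0 unit_symplectization lee_form (\<lambda>x. momentum x $ k) x w)"
      unfolding hamiltonian_direction[OF x] by simp
    have "((axis k 0, 0), 0) = (0 :: 'n tvec)" by (simp add: zero_prod_def)
    then show "\<phi> 0 x = x" by (simp only: \<phi> cover_0 add_0_right)
    show "\<phi> t x \<in> unit_symplectization" for t by (rule mem[OF x])
    show "has_velocity (\<lambda>s. \<phi> s x) (hamiltonian_vf unit_symplectization lee_form
      (conformal_form unit_torus_bundle liouville_form) (\<lambda>x. momentum x $ k) (\<phi> t x)) t UNIV" for t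
      using vel by (simp add: vf mem[OF x])
  qed
qed

text \<open>
  Translations have identity tangent maps, and the coefficients of \<open>\<omega>\<close> depend on \<open>p\<close> only.
\<close>

lemma preserves_conformal_form_translation:
  fixes \<phi> :: "real \<Rightarrow> 'n::finite pt \<Rightarrow> 'n pt"
  assumes \<phi>: "\<And>t x. \<phi> t x = x + cover (a t)" and a: "\<And>t. momentum (a t) = 0"
  shows "preserves_form2 unit_symplectization \<phi> (conformal_form unit_torus_bundle liouville_form)"
  unfolding preserves_form2_def pullback2_def
proof (intro allI ballI)
  fix t and x :: "'n pt" and v w :: "'n tvec"
  assume x: "x \<in> unit_symplectization" and vw: "v \<in> tangent_space unit_symplectization x"
    "w \<in> tangent_space unit_symplectization x"
  have mom: "momentum (\<phi> t x) = momentum x" by (simp add: \<phi> momentum_cover a)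
  have \<phi>x: "\<phi> t x \<in> unit_symplectization" using x by (simp add: mem_unit_symplectization mom)
  have "\<phi> t (y + cover z) = \<phi> t y + cover z" for y z by (simp add: \<phi> add_ac)
  then have "tangent_map unit_symplectization (\<phi> t) x u = u"
    if "u \<in> tangent_space unit_symplectization x" for u
    using that by (rule tangent_map_translation)
  then show "conformal_form unit_torus_bundle liouville_form (\<phi> t x)
      (tangent_map unit_symplectization (\<phi> t) x v) (tangent_map unit_symplectization (\<phi> t) x w) =
      conformal_form unit_torus_bundle liouville_form x v w"
    using vw by (simp add: tangent_space_unit_symplectization[OF x] conformal_form_eq[OF x]
        conformal_form_eq[OF \<phi>x] mom)
qed

text \<open>
  The \<open>S\<^sup>1\<close> factor is a loop that winds once around \<open>\<theta>\<close>, and it can be placed over any \<open>y\<close>.  For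
  the zero level it remains to choose \<open>y\<close>.
\<close>

lemma exists_loop_in_fibre:
  fixes y :: "'n::finite cotangent"
  obtains \<gamma> \<gamma>' where "C1_loop \<gamma> \<gamma>'" "\<And>t. fst (\<gamma> t) = y" "loop_integral lee_form \<gamma> \<gamma>' \<noteq> 0"
proof
  define \<gamma> where "\<gamma> t = (y, circle_of t)" for t
  define \<gamma>' :: "real \<Rightarrow> 'n tvec" where "\<gamma>' t = (0, 1)" for t
  have "has_velocity \<gamma> (\<gamma>' t) t {0..1}" for t
  proof (rule has_velocity_cover[where g = "\<lambda>s. (0, s - t)"])
    show "(0, t - t) = (0 :: 'n tvec)" by (simp add: zero_prod_def)
    show "((\<lambda>s. (0, s - t) :: 'n tvec) has_vector_derivative \<gamma>' t) (at t within {0..1})"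
      unfolding \<gamma>'_def
      by (auto intro!: has_vector_derivative_Pair derivative_eq_intros
          simp: has_real_derivative_iff_has_vector_derivative[symmetric])
    show "\<gamma> s = \<gamma> t + cover (0, s - t)" for s
      by (simp add: \<gamma>_def cover_eq prod_eq_iff vec_eq_iff circle_of_0 flip: circle_of_add)
  qed
  then show "C1_loop \<gamma> \<gamma>'"
    by (simp add: C1_loop_def \<gamma>'_def \<gamma>_def circle_of_eq_iff)
  show "fst (\<gamma> t) = y" for t by (simp add: \<gamma>_def)
  show "loop_integral lee_form \<gamma> \<gamma>' \<noteq> 0"
    by (simp add: loop_integral_def lee_form_def d_theta_def \<gamma>'_def)
qed

theorem proposition17:
  fixes k :: "'n::finite"
    and M :: "'n pt set" and \<eta> :: "'n form1" and \<omega> :: "'n form2"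
    and H :: "'n pt \<Rightarrow> real" and \<phi> :: "real \<Rightarrow> 'n pt \<Rightarrow> 'n pt"
  assumes "M = symplectization unit_torus_bundle"
    and "\<eta> = lee_form"
    and "\<omega> = conformal_form unit_torus_bundle liouville_form"
    and "H = (\<lambda>((q, p), \<theta>). p $ k)"
    and "\<phi> = (\<lambda>t ((q, p), \<theta>). ((\<chi> i. if i = k then q $ i + circle_of t else q $ i, p), \<theta>))"
  shows "is_hamiltonian_flow M \<eta> \<omega> H \<phi> \<and>
    preserves_form2 M \<phi> \<omega> \<and>
    (CARD('n) \<ge> 2 \<longrightarrow>
       (\<exists>\<gamma> \<gamma>'. C1_loop \<gamma> \<gamma>' \<and> (\<forall>t \<in> {0..1}. \<gamma> t \<in> M \<and> H (\<gamma> t) = 0) \<and>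
          loop_integral \<eta> \<gamma> \<gamma>' \<noteq> 0))"
proof -
  have H: "H = (\<lambda>x. momentum x $ k)" by (auto simp: assms(4))
  have \<phi>: "\<phi> t x = x + cover ((axis k t, 0), 0)" for t x
    by (auto simp: assms(5) cover_eq axis_def circle_of_0 prod_eq_iff vec_eq_iff split: prod.splits)
  have "\<exists>\<gamma> \<gamma>'. C1_loop \<gamma> \<gamma>' \<and> (\<forall>t \<in> {0..1}. \<gamma> t \<in> M \<and> H (\<gamma> t) = 0) \<and>
      loop_integral \<eta> \<gamma> \<gamma>' \<noteq> 0" if "CARD('n) \<ge> 2"
  proof -
    have "\<not> (UNIV :: 'n set) \<subseteq> {k}"
    proof
      assume "(UNIV :: 'n set) \<subseteq> {k}"
      then have "CARD('n) \<le> card {k}" by (intro card_mono) simp_all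
      with that show False by simp
    qed
    then obtain j where j: "j \<noteq> k" by blast
    obtain \<gamma> :: "real \<Rightarrow> 'n pt" and \<gamma>' where \<gamma>: "C1_loop \<gamma> \<gamma>'"
      "\<And>t. fst (\<gamma> t) = (0, axis j 1)" "loop_integral lee_form \<gamma> \<gamma>' \<noteq> 0"
      using exists_loop_in_fibre[of "(0, axis j 1)"] by blast
    have "\<gamma> t \<in> M \<and> H (\<gamma> t) = 0" for t
      using j by (simp add: assms(1) H mem_unit_symplectization \<gamma>(2)) (simp add: axis_def)
    with \<gamma> show ?thesis unfolding assms(2) by blast
  qed
  then show ?thesis
    using hamiltonian_flow_momentum[OF \<phi>] preserves_conformal_form_translation[OF \<phi>]
    by (simp add: assms(1-3) H)
qed

end
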